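(* Let $f=a_0+a_1x+\cdots+a_nx^n\in\mathbb{Z}[x]$ be a primitive polynomial such that there exist a prime number $p$ and an index $j$ with $1\leq j\leq n$ for which the following hold: (i) $v_p(a_j)=0$; (ii) $\frac{v_p(a_0)}{j}<\frac{v_p(a_i)}{j-i}$ for each $i=1,\ldots,j-1$; (iii) $\gcd(v_p(a_0),\,j)=1$. Let $d=a_0/p^{v_p(a_0)}$. If either $j=n$, or each zero $\theta\in\mathbb{C}$ of $f$ satisfies $|\theta|>d$, then $f$ is irreducible in $\mathbb{Z}[x]$.
   Context: For a prime $p$, $v_p$ denotes the $p$-adic valuation: $v_p(0)=\infty$ and for a nonzero integer $a$, $v_p(a)$ is the largest nonnegative integer $e$ with $p^e\mid a$. A polynomial in $\mathbb{Z}[x]$ is primitive if the gcd of its coefficients is $1$.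
   Formalization: The condition on the zeros is taken as |θ| > |d| instead of |θ| > d; for negative a_0 the claim as written fails, e.g. x^2+x-6=(x-2)(x+3) with p=2, j=1, d=-3. *)

theory Defs
  imports
    "HOL-Computational_Algebra.Computational_Algebra"
    "HOL-Library.Extended_Nat"
    "HOL-Library.Extended_Real"
begin

(* multiplicity is 0 by convention at 0, so the value \<infinity> there has to be set by hand. *)
definition padic_val :: "nat \<Rightarrow> int \<Rightarrow> enat" where
  "padic_val p a = (if a = 0 then \<infinity> else enat (multiplicity (int p) a))"

(* a0 / p^v_p(a0), keeping the sign of a0.  For a0 = 0 the exponent the_enat \<infinity> is
   unspecified, but the quotient is 0 whatever it is. *)
definition prime_free_part :: "nat \<Rightarrow> int \<Rightarrow> real" where
  "prime_free_part p a = real_of_int a / real p ^ the_enat (padic_val p a)"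

end

theory Submission
  imports Defs
begin

text \<open>
  Let k = v_p(a_0). Give a monomial a x^i the weight j v_p(a) + k i. The hypotheses say that every
  nonzero monomial of f has weight at least j k, with equality exactly at i = 0 and i = j (if
  k > 0). If f = g h, the minimal weights of g and h add up to j k and are attained at i = 0, and
  the last positions S and T where they are attained satisfy S + T = j. Equality of the weights of
  g at 0 and S gives j | k S, so S = 0 or S = j by coprimality. Hence one factor has degree at
  least j, and p does not divide the constant coefficient of the other one. If j = n, that other
  factor is constant, hence a unit. Otherwise its constant coefficient divides d, whereas its
  roots would force that coefficient to exceed \<bar>d\<bar> unless it is constant.
\<close>

text \<open>The level lines of the weight are parallel to the segment from (0, k) to (j, 0) of the
  Newton polygon; the factor \<open>j\<close> clears denominators. At a zero coefficient the value
  is meaningless, since \<open>multiplicity p 0 = 0\<close>, so every use is guarded by a nonzero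
  coefficient.\<close>

definition weight :: "int \<Rightarrow> nat \<Rightarrow> nat \<Rightarrow> int poly \<Rightarrow> nat \<Rightarrow> nat" where
  "weight p j k f i = j * multiplicity p (coeff f i) + k * i"

text \<open>This is the ultrametric inequality for the valuation; the disjunct with 0 stands in for
  the infinite valuation of 0. In its uses \<open>c\<close> is \<open>k * i\<close> for the one
  position \<open>i\<close> under consideration.\<close>

lemma heavy_add:
  fixes p a b :: int
  assumes "prime p"
    and "a = 0 \<or> m < j * multiplicity p a + c"
    and "b = 0 \<or> m < j * multiplicity p b + c"
  shows "a + b = 0 \<or> m < j * multiplicity p (a + b) + c"
proof (cases "a = 0 \<or> b = 0 \<or> a + b = 0")
  case False
  define e where "e = min (multiplicity p a) (multiplicity p b)"
  have "p ^ e dvd a + b"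
    unfolding e_def by (intro dvd_add multiplicity_dvd') auto
  then have "e \<le> multiplicity p (a + b)"
    using False assms(1) by (intro multiplicity_geI) auto
  then have "j * e \<le> j * multiplicity p (a + b)" by simp
  moreover have "m < j * e + c"
    using False assms by (auto simp: e_def min_def)
  ultimately have "m < j * multiplicity p (a + b) + c" by linarith
  then show ?thesis ..
qed (use assms in auto)

lemma heavy_sum:
  fixes p :: int and a :: "'b \<Rightarrow> int"
  assumes "prime p"
    and "\<And>x. x \<in> A \<Longrightarrow> a x = 0 \<or> m < j * multiplicity p (a x) + c"
  shows "sum a A = 0 \<or> m < j * multiplicity p (sum a A) + c"
  using assms(2)
proof (induction A rule: infinite_finite_induct)
  case (insert x A)
  have "a x + sum a A = 0 \<or> m < j * multiplicity p (a x + sum a A) + c"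
    using insert by (intro heavy_add assms(1)) auto
  with insert show ?case by simp
qed auto

text \<open>Taking the last minimal position gives strictness to its right. Of all pairs of
  positions with sum \<open>S + T\<close>, only (S, T) then escapes having a strictly heavier
  member.\<close>

lemma last_minimal_weight:
  assumes "g \<noteq> 0"
  obtains S where "coeff g S \<noteq> 0"
    and "\<And>i. coeff g i \<noteq> 0 \<Longrightarrow> weight p j k g S \<le> weight p j k g i"
    and "\<And>i. coeff g i \<noteq> 0 \<Longrightarrow> S < i \<Longrightarrow> weight p j k g S < weight p j k g i"
proof -
  let ?w = "weight p j k g"
  define I where "I = {i. coeff g i \<noteq> 0}"
  have fin: "finite I"
    unfolding I_def by (rule finite_subset[of _ "{..degree g}"]) (auto intro: le_degree)
  have "degree g \<in> I" using assms by (simp add: I_def)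
  define M where "M = Min (?w ` I)"
  have M_le: "M \<le> ?w i" if "i \<in> I" for i
    using fin that by (simp add: M_def)
  have "M \<in> ?w ` I"
    unfolding M_def using fin \<open>degree g \<in> I\<close> by (intro Min_in) auto
  define J where "J = {i \<in> I. ?w i = M}"
  have J: "finite J" "J \<noteq> {}" using fin \<open>M \<in> ?w ` I\<close> by (auto simp: J_def)
  have S: "Max J \<in> I" "?w (Max J) = M"
    using Max_in[OF J] by (auto simp: J_def)
  have "M \<noteq> ?w i" if "i \<in> I" "Max J < i" for i
    using Max_ge[OF J(1), of i] that by (auto simp: J_def)
  then show thesis
    using S M_le by (intro that[of "Max J"]) (auto simp: I_def order.strict_iff_order)
qed

text \<open>By coprimality the segment from (0, k) to (j, 0) has no lattice point in its interior,
  so a factorization cannot split it: one factor inherits it whole.\<close>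

lemma newton_edge_factor:
  fixes p :: int and g h :: "int poly"
  assumes p: "prime p"
    and a0: "coeff (g * h) 0 \<noteq> 0"
    and k: "k = multiplicity p (coeff (g * h) 0)"
    and j: "1 \<le> j" "j \<le> degree (g * h)"
    and aj: "\<not> p dvd coeff (g * h) j"
    and edge: "\<And>i. 1 \<le> i \<Longrightarrow> i < j \<Longrightarrow> coeff (g * h) i \<noteq> 0 \<Longrightarrow>
      k * (j - i) < j * multiplicity p (coeff (g * h) i)"
    and cop: "coprime k j"
  shows "\<not> p dvd coeff g 0 \<and> j \<le> degree h \<or> \<not> p dvd coeff h 0 \<and> j \<le> degree g"
proof -
  have [simp]: "coeff (g * h) 0 = coeff g 0 * coeff h 0"
    by (simp add: coeff_mult)
  have g0: "coeff g 0 \<noteq> 0" and h0: "coeff h 0 \<noteq> 0" using a0 by auto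
  then have nz: "g \<noteq> 0" "h \<noteq> 0" by auto
  have mult: "multiplicity p (a * b) = multiplicity p a + multiplicity p b"
    if "a \<noteq> 0" "b \<noteq> 0" for a b :: int
    using p that by (intro prime_elem_multiplicity_mult_distrib prime_imp_prime_elem)
  have ksum: "k = multiplicity p (coeff g 0) + multiplicity p (coeff h 0)"
    using k mult g0 h0 by simp
  have not_dvd: "\<not> p dvd a" if "a \<noteq> 0" "multiplicity p a = 0" for a :: int
    using prime_elem_multiplicity_eq_zero_iff[OF prime_imp_prime_elem[OF p]] that by blast
  show ?thesis
  proof (cases "k = 0")
    \<comment> \<open>For k = 0 monomials beyond x^j can also have weight j k, so weights do not
      single out j; but coprimality then forces j = 1.\<close>
    case True
    then have "j = 1" using cop by simp
    then have "1 \<le> degree g \<or> 1 \<le> degree h"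
      using j nz by (auto simp: degree_mult_eq)
    then show ?thesis
      using True ksum \<open>j = 1\<close> not_dvd g0 h0 by auto
  next
    case False
    let ?w = "weight p j k"
    obtain S where S: "coeff g S \<noteq> 0" "\<And>i. coeff g i \<noteq> 0 \<Longrightarrow> ?w g S \<le> ?w g i"
      "\<And>i. coeff g i \<noteq> 0 \<Longrightarrow> S < i \<Longrightarrow> ?w g S < ?w g i"
      using last_minimal_weight[OF nz(1), of p j k] by blast
    obtain T where T: "coeff h T \<noteq> 0" "\<And>i. coeff h i \<noteq> 0 \<Longrightarrow> ?w h T \<le> ?w h i"
      "\<And>i. coeff h i \<noteq> 0 \<Longrightarrow> T < i \<Longrightarrow> ?w h T < ?w h i"
      using last_minimal_weight[OF nz(2), of p j k] by blast
    define M where "M = ?w g S + ?w h T"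
    have prod_weight: "j * multiplicity p (coeff g i * coeff h i') + k * (i + i') = ?w g i + ?w h i'"
      if "coeff g i \<noteq> 0" "coeff h i' \<noteq> 0" for i i'
      using that mult by (simp add: weight_def algebra_simps)
    have heavy: "coeff g i * coeff h i' = 0 \<or>
        M < j * multiplicity p (coeff g i * coeff h i') + k * (i + i')"
      if "S < i \<or> T < i'" for i i'
    proof (cases "coeff g i = 0 \<or> coeff h i' = 0")
      case False
      then have "M < ?w g i + ?w h i'"
        using that S(2,3)[of i] T(2,3)[of i'] by (auto simp: M_def)
      with False prod_weight show ?thesis by simp
    qed auto
    have above: "coeff (g * h) i = 0 \<or> M < ?w (g * h) i" if "S + T < i" for i
    proof -
      have "(\<Sum>r\<le>i. coeff g r * coeff h (i - r)) = 0 \<or>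
          M < j * multiplicity p (\<Sum>r\<le>i. coeff g r * coeff h (i - r)) + k * i"
      proof (rule heavy_sum[OF p])
        fix r assume "r \<in> {..i}"
        then have "r + (i - r) = i" and "S < r \<or> T < i - r" using that by auto
        with heavy[of r "i - r"] show "coeff g r * coeff h (i - r) = 0 \<or>
          M < j * multiplicity p (coeff g r * coeff h (i - r)) + k * i" by simp
      qed
      then show ?thesis by (simp add: weight_def coeff_mult)
    qed
    \<comment> \<open>All terms of this coefficient other than that of (S, T) are heavier than
      \<open>M\<close>. Were the whole coefficient zero or heavier too, subtracting those terms
      would make the (S, T) term heavy, yet its weight is exactly \<open>M\<close>.\<close>
    have at: "coeff (g * h) (S + T) \<noteq> 0 \<and> ?w (g * h) (S + T) \<le> M"
    proof (rule ccontr)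
      assume "\<not> ?thesis"
      then have c: "coeff (g * h) (S + T) = 0 \<or>
          M < j * multiplicity p (coeff (g * h) (S + T)) + k * (S + T)"
        by (auto simp: weight_def)
      let ?t = "\<lambda>r. - (coeff g r * coeff h (S + T - r))"
      have "sum ?t ({..S+T} - {S}) = 0 \<or>
          M < j * multiplicity p (sum ?t ({..S+T} - {S})) + k * (S + T)"
      proof (rule heavy_sum[OF p])
        fix r assume "r \<in> {..S+T} - {S}"
        then have "r + (S + T - r) = S + T" and "S < r \<or> T < S + T - r" by auto
        with heavy[of r "S + T - r"] show "?t r = 0 \<or> M < j * multiplicity p (?t r) + k * (S + T)"
          by simp
      qed
      from heavy_add[OF p c this]
      have "coeff g S * coeff h T = 0 \<or> M < j * multiplicity p (coeff g S * coeff h T) + k * (S + T)"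
        by (simp add: coeff_mult sum.remove[of "{..S+T}" S] sum_negf)
      then show False
        using S(1) T(1) prod_weight[OF S(1) T(1)] by (simp add: M_def)
    qed
    \<comment> \<open>Below j this is the slope hypothesis; beyond j the summand
      \<open>k * i\<close> alone suffices, as k > 0.\<close>
    have weight_f: "j * k < ?w (g * h) i" if "coeff (g * h) i \<noteq> 0" "i \<noteq> 0" "i \<noteq> j" for i
    proof (cases "i < j")
      case True
      have "j * k = k * (j - i) + k * i"
        using True by (simp add: algebra_simps flip: distrib_left)
      with edge[of i] True that show ?thesis by (simp add: weight_def)
    next
      case False
      with that \<open>k \<noteq> 0\<close> have "k * j < k * i" by simp
      then show ?thesis unfolding weight_def mult.commute[of j k] by linarith
    qed
    have weight_0: "?w (g * h) 0 = j * k"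
      using k by (simp add: weight_def)
    have weight_j: "?w (g * h) j = j * k"
      using aj by (simp add: weight_def not_dvd_imp_multiplicity_0)
    have w0: "?w g 0 + ?w h 0 = j * k"
      using ksum by (simp add: weight_def algebra_simps)
    have "M \<le> j * k"
      using S(2)[OF g0] T(2)[OF h0] w0 by (simp add: M_def)
    then have "S + T = 0 \<or> S + T = j"
      using at weight_f[of "S + T"] by fastforce
    then have M: "M = j * k"
      using at \<open>M \<le> j * k\<close> weight_0 weight_j by auto
    have "coeff (g * h) j \<noteq> 0" using aj by auto
    \<comment> \<open>The coefficient at j is nonzero of weight exactly \<open>M\<close>, while
      everything beyond \<open>S + T\<close> is heavier. This rules out
      \<open>S + T = 0\<close>.\<close>
    then have "j \<le> S + T"
      using above[of j] weight_j M by (metis leI less_irrefl)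
    with \<open>S + T = 0 \<or> S + T = j\<close> j have ST: "S + T = j" by auto
    have wS: "?w g S = ?w g 0" and wT: "?w h T = ?w h 0"
      using S(2)[OF g0] T(2)[OF h0] w0 M by (auto simp: M_def)
    \<comment> \<open>The passage to integers avoids truncated subtraction of
      multiplicities.\<close>
    have "int k * int S = int j * (int (multiplicity p (coeff g 0)) - int (multiplicity p (coeff g S)))"
      using wS by (simp add: weight_def algebra_simps flip: of_nat_mult of_nat_add)
    then have "int j dvd int k * int S" by simp
    then have "j dvd k * S" by (simp flip: of_nat_mult)
    then have "j dvd S"
      using cop by (simp add: coprime_commute coprime_dvd_mult_right_iff)
    then have "S = 0 \<or> j \<le> S" by (auto dest: dvd_imp_le)
    then consider "S = 0" "T = j" | "S = j" "T = 0"
      using ST by linarith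
    then show ?thesis
    proof cases
      case 1
      \<comment> \<open>Equal weights at 0 and j give v_p(h_j) + k = v_p(h_0), and v_p(h_0) is at
        most k, so all of k sits in h_0 and none in g_0.\<close>
      have "j * (multiplicity p (coeff h j) + k) = j * multiplicity p (coeff h 0)"
        using wT 1 by (simp add: weight_def algebra_simps)
      then have "multiplicity p (coeff h j) + k = multiplicity p (coeff h 0)" using j by simp
      then have "multiplicity p (coeff g 0) = 0" using ksum by simp
      then show ?thesis using 1 T(1) not_dvd g0 by (auto intro: le_degree)
    next
      case 2
      have "j * (multiplicity p (coeff g j) + k) = j * multiplicity p (coeff g 0)"
        using wS 2 by (simp add: weight_def algebra_simps)
      then have "multiplicity p (coeff g j) + k = multiplicity p (coeff g 0)" using j by simp
      then have "multiplicity p (coeff h 0) = 0" using ksum by simp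
      then show ?thesis using 2 S(1) not_dvd h0 by (auto intro: le_degree)
    qed
  qed
qed

text \<open>Up to sign the constant coefficient is the leading one times the product of the roots.
  One root contributes more than r, and since r is at least 1 the remaining ones cannot shrink the
  product.\<close>

lemma norm_coeff_0_gt:
  fixes q :: "complex poly"
  assumes "1 \<le> r" "1 \<le> norm (lead_coeff q)" "0 < degree q"
    and "\<And>z. poly q z = 0 \<Longrightarrow> r < norm z"
  shows "r < norm (coeff q 0)"
proof -
  have "q \<noteq> 0" using assms by auto
  then obtain A where A: "size A = degree q" "q = smult (lead_coeff q) (\<Prod>x\<in>#A. [:-x, 1:])"
    using alg_closed_imp_factorization by blast
  have q_eq: "poly q z = lead_coeff q * (\<Prod>x\<in>#A. z - x)" for z
    by (subst A(2)) (simp add: poly_prod_mset multiset.map_comp o_def)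
  have root: "r < norm x" if "x \<in># A" for x
  proof -
    have "(\<Prod>y\<in>#A. x - y) = 0" using that by (auto simp: prod_mset_zero_iff)
    then show ?thesis using q_eq assms(4) by simp
  qed
  have prod_gt: "B \<noteq> {#} \<longrightarrow> r < norm (\<Prod>x\<in>#B. - x)" if "\<And>x. x \<in># B \<Longrightarrow> r < norm x" for B :: "complex multiset"
    using that
  proof (induction B)
    case (add x B)
    show ?case
    proof (cases "B = {#}")
      case False
      then have "1 < norm (\<Prod>x\<in>#B. - x)" "r < norm x" using add assms(1) by fastforce+
      then have "r * 1 < norm x * norm (\<Prod>x\<in>#B. - x)"
        using assms(1) by (intro mult_strict_mono) auto
      then show ?thesis by (simp add: norm_mult)
    qed (use add in simp)
  qed simp
  have "A \<noteq> {#}" using A(1) assms(3) by auto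
  then have "r < norm (\<Prod>x\<in>#A. - x)" using prod_gt root by blast
  also have "\<dots> \<le> norm (lead_coeff q) * norm (\<Prod>x\<in>#A. - x)"
    using assms(2) by (simp add: mult_le_cancel_right1)
  also have "\<dots> = norm (coeff q 0)"
    using q_eq[of 0] by (simp add: norm_mult poly_0_coeff_0)
  finally show ?thesis .
qed

lemma abs_coeff_0_gt:
  fixes h :: "int poly"
  assumes "1 \<le> r" "0 < degree h"
    and "\<And>z::complex. poly (map_poly of_int h) z = 0 \<Longrightarrow> r < cmod z"
  shows "r < \<bar>real_of_int (coeff h 0)\<bar>"
proof -
  let ?q = "map_poly of_int h :: complex poly"
  have deg: "degree ?q = degree h" by (simp add: degree_map_poly)
  have "lead_coeff h \<noteq> 0" using assms(2) by auto
  then have "1 \<le> \<bar>lead_coeff h\<bar>" by linarith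
  then have "1 \<le> cmod (lead_coeff ?q)"
    by (simp add: deg coeff_map_poly)
  then have "r < cmod (coeff ?q 0)"
    using assms deg by (intro norm_coeff_0_gt) auto
  then show ?thesis by (simp add: coeff_map_poly)
qed

theorem theorem3:
  fixes f :: "int poly" and n p j :: nat and d :: real
  assumes "n = degree f"
    and "content f = 1"
    and "prime p"
    and "1 \<le> j" and "j \<le> n"
    and "padic_val p (coeff f j) = 0"
    and "\<And>i. 1 \<le> i \<Longrightarrow> i \<le> j - 1 \<Longrightarrow>
           ereal_of_enat (padic_val p (coeff f 0)) / ereal (real j)
             < ereal_of_enat (padic_val p (coeff f i)) / ereal (real j - real i)"
    and "gcd (the_enat (padic_val p (coeff f 0))) j = 1"
    and "d = prime_free_part p (coeff f 0)"
    and "j = n \<or> (\<forall>\<theta>::complex. poly (map_poly of_int f) \<theta> = 0 \<longrightarrow> cmod \<theta> > \<bar>d\<bar>)"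
  shows "irreducible f"
proof -
  let ?p = "int p"
  have pp: "prime ?p" using assms(3) by simp
  have "f \<noteq> 0" using assms(2) by auto
  \<comment> \<open>A constant divisor of f divides its content, which is 1.\<close>
  have factor_unit: "is_unit h" if "h dvd f" "degree h = 0" for h
  proof -
    obtain c where "h = [:c:]" using \<open>degree h = 0\<close> by (auto elim: degree_eq_zeroE)
    with that assms(2) show ?thesis
      by (simp add: const_poly_dvd_iff_dvd_content is_unit_const_poly_iff)
  qed
  have aj: "coeff f j \<noteq> 0 \<and> \<not> ?p dvd coeff f j"
    using assms(3,6) pp
    by (auto simp: padic_val_def zero_enat_def prime_elem_multiplicity_eq_zero_iff split: if_splits)
  have nonunit: "\<not> is_unit f"
    using assms(1,4,5) by (auto simp: is_unit_poly_iff)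
  have fac: "is_unit g \<or> is_unit h" if f: "f = g * h" for g h
  proof (cases "coeff f 0 = 0")
    \<comment> \<open>Here v_p(a_0) is infinite, so the strict inequality fails at i = 1 and j must
      be 1. As 0 is a root of f, the root condition fails as well, leaving j = n: f is
      linear.\<close>
    case True
    have "j = 1"
    proof (rule ccontr)
      assume "j \<noteq> 1"
      then have "1 \<le> j - 1" using assms(4) by simp
      from assms(7)[OF order_refl this] assms(4) True show False by (simp add: padic_val_def)
    qed
    have "j = n"
    proof (rule ccontr)
      assume "j \<noteq> n"
      moreover have "poly (map_poly of_int f) (0::complex) = 0"
        using True by (simp add: poly_0_coeff_0 coeff_map_poly)
      ultimately show False using assms(10) by fastforce
    qed
    with \<open>j = 1\<close> have "degree g = 0 \<or> degree h = 0"
      using assms(1) f \<open>f \<noteq> 0\<close> by (auto simp: degree_mult_eq)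
    then show ?thesis using factor_unit f by auto
  next
    case a0: False
    define k where "k = multiplicity ?p (coeff f 0)"
    have the_k: "the_enat (padic_val p (coeff f 0)) = k" "padic_val p (coeff f 0) = enat k"
      using a0 by (simp_all add: padic_val_def k_def)
    have edge: "k * (j - i) < j * multiplicity ?p (coeff f i)"
      if i: "1 \<le> i" "i < j" "coeff f i \<noteq> 0" for i
    proof -
      have "real k / real j < real (multiplicity ?p (coeff f i)) / (real j - real i)"
        using assms(7)[of i] i the_k by (simp add: padic_val_def)
      then have "real k * real (j - i) < real j * real (multiplicity ?p (coeff f i))"
        using i by (simp add: field_simps of_nat_diff)
      then show ?thesis by (simp flip: of_nat_mult)
    qed
    have cases: "\<not> ?p dvd coeff g 0 \<and> j \<le> degree h \<or> \<not> ?p dvd coeff h 0 \<and> j \<le> degree g"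
      by (rule newton_edge_factor[where k = k])
        (use pp a0 f k_def assms(1,4,5,8) aj edge the_k in \<open>auto simp: coprime_iff_gcd_eq_1\<close>)
    have key: "is_unit v" if uv: "f = u * v" and v: "\<not> ?p dvd coeff v 0" "j \<le> degree u" for u v
    proof (rule ccontr)
      assume "\<not> is_unit v"
      then have deg_v: "0 < degree v" using factor_unit uv by (metis dvd_triv_right gr0I)
      have "u \<noteq> 0" "v \<noteq> 0" using uv \<open>f \<noteq> 0\<close> by auto
      then have "degree f = degree u + degree v" using uv by (simp add: degree_mult_eq)
      then have "j \<noteq> n" using deg_v v assms(1) by auto
      then have roots: "\<bar>d\<bar> < cmod z" if "poly (map_poly of_int f) z = 0" for z
        using assms(10) that by auto
      have c0: "coeff f 0 = coeff u 0 * coeff v 0" using uv by (simp add: coeff_mult)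
      \<comment> \<open>Since p does not divide v(0), the full power p^k divides u(0). Hence d is an
        integer multiple of v(0).\<close>
      have "?p ^ k dvd coeff u 0 * coeff v 0"
        using multiplicity_dvd[of ?p "coeff f 0"] by (simp add: k_def c0)
      moreover have "coprime (?p ^ k) (coeff v 0)"
        using pp v(1) by (simp add: prime_imp_coprime)
      ultimately have "?p ^ k dvd coeff u 0" by (simp add: coprime_dvd_mult_left_iff)
      then obtain c where c: "coeff u 0 = ?p ^ k * c" by blast
      have d: "d = real_of_int (c * coeff v 0)"
        using assms(3) unfolding assms(9) prime_free_part_def the_k
        by (simp add: c0 c prime_gt_0_nat)
      have "c \<noteq> 0" "coeff v 0 \<noteq> 0" using a0 c0 c by auto
      then have "1 \<le> \<bar>c\<bar>" "1 \<le> \<bar>coeff v 0\<bar>" by linarith+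
      then have "1 * \<bar>coeff v 0\<bar> \<le> \<bar>c\<bar> * \<bar>coeff v 0\<bar>" by (intro mult_right_mono) auto
      then have le: "\<bar>coeff v 0\<bar> \<le> \<bar>c * coeff v 0\<bar>" by (simp add: abs_mult)
      then have "\<bar>real_of_int (coeff v 0)\<bar> \<le> \<bar>d\<bar>" unfolding d by linarith
      moreover have "\<bar>d\<bar> < \<bar>real_of_int (coeff v 0)\<bar>"
      proof (rule abs_coeff_0_gt[OF _ deg_v])
        \<comment> \<open>As a nonzero integer, d is large enough to serve as the bound r on the
          roots.\<close>
        show "1 \<le> \<bar>d\<bar>" unfolding d using le \<open>1 \<le> \<bar>coeff v 0\<bar>\<close> by linarith
        fix z :: complex assume "poly (map_poly of_int v) z = 0"
        moreover have "(map_poly of_int f :: complex poly) = map_poly of_int u * map_poly of_int v"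
          by (rule poly_eqI) (simp add: uv coeff_map_poly coeff_mult)
        ultimately show "\<bar>d\<bar> < cmod z" by (intro roots) simp
      qed
      ultimately show False by simp
    qed
    from cases show ?thesis using key[of g h] key[of h g] f by (auto simp: mult.commute)
  qed
  show ?thesis by (rule irreducibleI[OF \<open>f \<noteq> 0\<close> nonunit fac])
qed

end
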